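(* For each ample ring $R$, $\dim(R)\ge\mathfrak{c}$. In particular, $R$ has infinite Krull dimension.
   Context: $\mathfrak{c}$ is the cardinality of the continuum. For a commutative ring $R$, the Krull dimension $\dim(R)$ is the supremum of the cardinalities of lengths of chains (families totally ordered by inclusion) of distinct proper prime ideals in $R$; a finite chain $\mathfrak p_0\subsetneq\dots\subsetneq\mathfrak p_n$ has length $n$ and the length of an infinite chain is its cardinality. The inequality $\dim(R)\ge\mathfrak{c}$ is understood to mean that $R$ contains a chain of distinct prime ideals whose length has the cardinality of the continuum. Let $\mathbb{N}=\{1,2,3,\dots\}$ and fix a nonprincipal ultrafilter $\omega$ on $\mathbb{N}$. Let ${}^{*}\mathbb{R}=\prod_{k\in\mathbb{N}}\mathbb{R}/\omega$ be the corresponding ultrapower (ordered field); $[x_k]$ denotes the class of the sequence $(x_k)$, where two sequences are equivalent if they agree on a set belonging to $\omega$. The same notation $[x_k]$ is used for sequences in $[0,\infty]$. Let ${}^{*}\mathbb{N}\subset{}^{*}\mathbb{R}$ be the set of classes $[n_k]$ of sequences of natural numbers. A valuation on a unital ring $R$ is a map $\nu:R\to[0,\infty)\cup\{\infty\}$ such that (1) $\nu(a+b)\ge\min(\nu(a),\nu(b))$; (2) $\nu(ab)=\nu(a)+\nu(b)$; (3) $\nu(a)=\infty\iff a=0$; (4) $\nu(1)=0$. A commutative unital ring $R$ is ample if there exists a sequence of valuations $(\nu_k)_{k\in\mathbb{N}}$ on $R$ such that for each $\beta\in{}^{*}\mathbb{N}$ there is $a=a_\beta\in R$ with $[\nu_k(a)]=\beta$.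 *)

theory Defs
  imports
    "HOL-Algebra.Ideal"
    "HOL-Library.Equipollence"
    "HOL-Library.Extended_Nat"
    "HOL-Library.Extended_Nonnegative_Real"
begin

section \<open>Krull dimension\<close>

definition prime_chain :: "('a, 'b) ring_scheme \<Rightarrow> 'a set set \<Rightarrow> bool" where
  "prime_chain R C \<longleftrightarrow> subset.chain {P. primeideal P R} C"

text \<open>A chain with \<open>n + 1\<close> members has length \<open>n\<close>. In \<^typ>\<open>enat\<close> all infinite cardinals are
  collapsed to \<open>\<infinity>\<close>, which suffices for expressing that the Krull dimension is infinite;
  the comparison with the continuum is formulated separately below.\<close>

definition chain_length :: "'a set set \<Rightarrow> enat" where
  "chain_length C = (if finite C then enat (card C - 1) else \<infinity>)"

definition krull_dim :: "('a, 'b) ring_scheme \<Rightarrow> enat" where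
  "krull_dim R = Sup {chain_length C |C. prime_chain R C \<and> C \<noteq> {}}"

text \<open>The length of an infinite chain is its cardinality, so \<open>dim R \<ge> \<cc>\<close> asks for a chain
  of distinct prime ideals that is equipollent to the real line.\<close>

definition krull_dim_ge_continuum :: "('a, 'b) ring_scheme \<Rightarrow> bool" where
  "krull_dim_ge_continuum R \<longleftrightarrow> (\<exists>C. prime_chain R C \<and> C \<approx> (UNIV :: real set))"


section \<open>Ultrapowers\<close>

text \<open>The index set is \<open>{1, 2, 3, \<dots>}\<close>. An ultrafilter on it is represented as a filter on
  \<^typ>\<open>nat\<close> that contains \<open>{1..}\<close>; the value of a sequence at \<open>0\<close> is then irrelevant.\<close>

definition nonprincipal_ultrafilter :: "nat filter \<Rightarrow> bool" where
  "nonprincipal_ultrafilter \<omega> \<longleftrightarrow>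
     \<omega> \<noteq> bot \<and> \<omega> \<le> principal {1..} \<and>
     (\<forall>P. eventually P \<omega> \<or> eventually (\<lambda>k. \<not> P k) \<omega>) \<and>
     (\<forall>k. \<omega> \<noteq> principal {k})"

definition seq_rel :: "nat filter \<Rightarrow> ((nat \<Rightarrow> 'a) \<times> (nat \<Rightarrow> 'a)) set" where
  "seq_rel \<omega> = {(x, y). eventually (\<lambda>k. x k = y k) \<omega>}"

definition seq_class :: "nat filter \<Rightarrow> (nat \<Rightarrow> 'a) \<Rightarrow> (nat \<Rightarrow> 'a) set" where
  "seq_class \<omega> x = seq_rel \<omega> `` {x}"

text \<open>The hypernaturals are taken as classes of \<open>[0,\<infinity>]\<close>-valued sequences, since they are
  compared with classes \<open>[\<nu>\<^sub>k(a)]\<close> of such sequences; this identifies the class of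
  \<open>(n\<^sub>k)\<close> in the ultrapower of the reals with its class in the ultrapower of \<open>[0,\<infinity>]\<close>.\<close>

definition hypernats :: "nat filter \<Rightarrow> (nat \<Rightarrow> ennreal) set set" where
  "hypernats \<omega> = {seq_class \<omega> (\<lambda>k. of_nat (n k)) |n :: nat \<Rightarrow> nat. \<forall>k\<ge>1. n k \<ge> 1}"


section \<open>Valuations and ample rings\<close>

definition valuation :: "('a, 'b) ring_scheme \<Rightarrow> ('a \<Rightarrow> ennreal) \<Rightarrow> bool" where
  "valuation R \<nu> \<longleftrightarrow>
     (\<forall>a\<in>carrier R. \<forall>b\<in>carrier R. \<nu> (a \<oplus>\<^bsub>R\<^esub> b) \<ge> min (\<nu> a) (\<nu> b)) \<and>
     (\<forall>a\<in>carrier R. \<forall>b\<in>carrier R. \<nu> (a \<otimes>\<^bsub>R\<^esub> b) = \<nu> a + \<nu> b) \<and>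
     (\<forall>a\<in>carrier R. \<nu> a = \<infinity> \<longleftrightarrow> a = \<zero>\<^bsub>R\<^esub>) \<and>
     \<nu> \<one>\<^bsub>R\<^esub> = 0"

definition ample :: "nat filter \<Rightarrow> ('a, 'b) ring_scheme \<Rightarrow> bool" where
  "ample \<omega> R \<longleftrightarrow>
     (\<exists>\<nu> :: nat \<Rightarrow> 'a \<Rightarrow> ennreal.
        (\<forall>k\<ge>1. valuation R (\<nu> k)) \<and>
        (\<forall>\<beta>\<in>hypernats \<omega>. \<exists>a\<in>carrier R. seq_class \<omega> (\<lambda>k. \<nu> k a) = \<beta>))"

end

theory Submission
  imports Defs
begin

text \<open>For a positive hyperreal \<open>[g\<^sub>k]\<close>, the elements whose valuation exceeds every standard
  multiple of \<open>[g\<^sub>k]\<close> form a prime ideal. If \<open>0 < s < t\<close>, then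
  \<open>[k\<^sup>t]\<close> exceeds every standard multiple of \<open>[k\<^sup>s]\<close>, and ampleness supplies an element of
  valuation \<open>\<lceil>k\<^sup>t\<rceil>\<close>, which lies in the ideal of \<open>[k\<^sup>s]\<close> but not in that of \<open>[k\<^sup>t]\<close>. So these
  ideals form a strictly decreasing chain indexed by the positive reals.\<close>

text \<open>An ultrafilter containing a singleton is principal, so \<open>\<omega>\<close> avoids
  every point and hence every finite initial segment. This lets asymptotic estimates in
  \<open>k\<close> pass to \<open>\<omega>\<close>.\<close>

lemma nonprincipal_ultrafilter_le_sequentially:
  assumes "nonprincipal_ultrafilter \<omega>"
  shows "\<omega> \<le> sequentially"
proof -
  note \<omega> = assms[unfolded nonprincipal_ultrafilter_def]
  have ne: "eventually (\<lambda>k. k \<noteq> j) \<omega>" for j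
  proof (rule ccontr)
    assume "\<not> eventually (\<lambda>k. k \<noteq> j) \<omega>"
    with \<omega> have ev: "eventually (\<lambda>k. k = j) \<omega>"
      by fastforce
    \<comment> \<open>Membership in the filter would be decided at \<open>j\<close> alone, making
      \<open>\<omega>\<close> the principal filter at \<open>j\<close>.\<close>
    have "eventually P \<omega> \<longleftrightarrow> P j" for P
    proof
      assume "eventually P \<omega>"
      with ev have "eventually (\<lambda>k. P j) \<omega>"
        by eventually_elim simp
      with \<omega> show "P j" by (cases "P j") (auto simp: eventually_False)
    next
      assume "P j"
      with ev show "eventually P \<omega>" by (auto elim: eventually_mono)
    qed
    hence "\<omega> = principal {j}"
      by (simp add: filter_eq_iff eventually_principal)
    with \<omega> show False by blast
  qed
  have "eventually (\<lambda>k. N \<le> k) \<omega>" for N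
  proof -
    have "eventually (\<lambda>k. \<forall>j\<in>{..<N}. k \<noteq> j) \<omega>"
      using ne by (simp add: eventually_ball_finite_distrib)
    thus ?thesis by (rule eventually_mono) (auto simp: not_less[symmetric])
  qed
  thus ?thesis
    by (metis eventually_sequentially filter_leI eventually_mono)
qed

text \<open>Comparison in the ultrapower is spelled out as an inequality holding eventually along
  \<open>\<omega>\<close>, so no quotient classes have to be ordered. Only the class of
  \<open>g\<close> matters.\<close>

definition dominating_ideal ::
  "('a, 'b) ring_scheme \<Rightarrow> nat filter \<Rightarrow> (nat \<Rightarrow> 'a \<Rightarrow> ennreal) \<Rightarrow> (nat \<Rightarrow> ennreal) \<Rightarrow> 'a set"
  where "dominating_ideal R \<omega> \<nu> g =
    {a \<in> carrier R. \<forall>n. eventually (\<lambda>k. of_nat n * g k \<le> \<nu> k a) \<omega>}"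

lemma dominating_ideal_antimono:
  assumes "eventually (\<lambda>k. g k \<le> h k) \<omega>"
  shows "dominating_ideal R \<omega> \<nu> h \<subseteq> dominating_ideal R \<omega> \<nu> g"
proof
  fix a assume a: "a \<in> dominating_ideal R \<omega> \<nu> h"
  have "eventually (\<lambda>k. of_nat n * g k \<le> \<nu> k a) \<omega>" for n
  proof -
    from a have "eventually (\<lambda>k. of_nat n * h k \<le> \<nu> k a) \<omega>"
      by (simp add: dominating_ideal_def)
    with assms show ?thesis
      by eventually_elim (meson mult_left_mono order_trans zero_le)
  qed
  with a show "a \<in> dominating_ideal R \<omega> \<nu> g"
    by (simp add: dominating_ideal_def)
qed

text \<open>Sums stay inside by the ultrametric inequality, products because the other factor adds a
  nonnegative value. Primality is where maximality of the filter enters: if \<open>a\<close> fails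
  against \<open>m\<close> and \<open>b\<close> against \<open>n\<close>, both fail on sets of the
  ultrafilter, and then \<open>a \<otimes> b\<close> fails against \<open>m + n\<close>.\<close>

lemma primeideal_dominating_ideal:
  fixes R :: "('a, 'b) ring_scheme" (structure)
  assumes "cring R"
    and nontriv: "\<omega> \<noteq> bot"
    and ultra: "\<And>P. eventually P \<omega> \<or> eventually (\<lambda>k. \<not> P k) \<omega>"
    and val: "eventually (\<lambda>k. valuation R (\<nu> k)) \<omega>"
    and pos: "eventually (\<lambda>k. 0 < g k) \<omega>"
  shows "primeideal (dominating_ideal R \<omega> \<nu> g) R"
proof -
  interpret cring R by fact
  let ?I = "dominating_ideal R \<omega> \<nu> g"
  have mem: "a \<in> ?I \<longleftrightarrow> a \<in> carrier R \<and> (\<forall>n. eventually (\<lambda>k. of_nat n * g k \<le> \<nu> k a) \<omega>)" for a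
    by (simp add: dominating_ideal_def)
  have zero: "\<zero> \<in> ?I"
    unfolding mem using val
    by (auto elim!: eventually_mono simp: valuation_def simp del: infinity_ennreal_def)
      (metis infinity_ennreal_def top_greatest zero_closed)
  have add: "a \<oplus> b \<in> ?I" if "a \<in> ?I" "b \<in> ?I" for a b
  proof -
    have "eventually (\<lambda>k. of_nat n * g k \<le> \<nu> k (a \<oplus> b)) \<omega>" for n
    proof -
      have "eventually (\<lambda>k. of_nat n * g k \<le> \<nu> k a) \<omega>" "eventually (\<lambda>k. of_nat n * g k \<le> \<nu> k b) \<omega>"
        using that by (auto simp: mem)
      with val show ?thesis
      proof eventually_elim
        case (elim k)
        hence "min (\<nu> k a) (\<nu> k b) \<le> \<nu> k (a \<oplus> b)"
          using that by (simp add: valuation_def mem)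
        with elim show ?case by (meson min.boundedI order_trans)
      qed
    qed
    with that show ?thesis by (simp add: mem)
  qed
  have mult: "a \<otimes> b \<in> ?I" if "a \<in> carrier R" "b \<in> ?I" for a b
  proof -
    have "eventually (\<lambda>k. of_nat n * g k \<le> \<nu> k (a \<otimes> b)) \<omega>" for n
    proof -
      have "eventually (\<lambda>k. of_nat n * g k \<le> \<nu> k b) \<omega>"
        using that by (auto simp: mem)
      with val show ?thesis
      proof eventually_elim
        case (elim k)
        hence "\<nu> k (a \<otimes> b) = \<nu> k a + \<nu> k b"
          using that by (simp add: valuation_def mem)
        with elim show ?case by (simp add: add_increasing)
      qed
    qed
    with that show ?thesis by (simp add: mem)
  qed
  \<comment> \<open>Negation is multiplication by the negative of one, so absorption covers
    it.\<close>
  have neg: "\<ominus> a \<in> ?I" if "a \<in> ?I" for a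
    using mult[of "\<ominus> \<one>" a] that by (simp add: mem l_minus)
  have "ideal ?I R"
  proof (rule idealI)
    show "subgroup ?I (add_monoid R)"
    proof (rule subgroup.intro)
      show "inv\<^bsub>add_monoid R\<^esub> a \<in> ?I" if "a \<in> ?I" for a
        using neg[OF that] by (simp add: a_inv_def)
    qed (use zero add in \<open>auto simp: mem\<close>)
    show "a \<otimes> x \<in> ?I" if "a \<in> ?I" "x \<in> carrier R" for a x
      using mult[of x a] that by (simp add: mem m_comm)
  qed (use mult in \<open>simp_all add: ring_axioms\<close>)
  moreover have "\<one> \<notin> ?I"
  proof
    assume "\<one> \<in> ?I"
    hence "eventually (\<lambda>k. of_nat 1 * g k \<le> \<nu> k \<one>) \<omega>"
      unfolding mem by blast
    with val pos have "eventually (\<lambda>k. False) \<omega>"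
      by eventually_elim (simp add: valuation_def)
    with nontriv show False by (simp add: eventually_False)
  qed
  moreover have "a \<in> ?I \<or> b \<in> ?I"
    if ab: "a \<in> carrier R" "b \<in> carrier R" "a \<otimes> b \<in> ?I" for a b
  proof (rule ccontr)
    assume "\<not> (a \<in> ?I \<or> b \<in> ?I)"
    then obtain m n where
      "\<not> eventually (\<lambda>k. of_nat m * g k \<le> \<nu> k a) \<omega>"
      "\<not> eventually (\<lambda>k. of_nat n * g k \<le> \<nu> k b) \<omega>"
      using ab by (auto simp: mem)
    hence "eventually (\<lambda>k. \<not> of_nat m * g k \<le> \<nu> k a) \<omega>"
      "eventually (\<lambda>k. \<not> of_nat n * g k \<le> \<nu> k b) \<omega>"
      using ultra by blast+
    moreover have "eventually (\<lambda>k. of_nat (m + n) * g k \<le> \<nu> k (a \<otimes> b)) \<omega>"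
      using ab unfolding mem by blast
    ultimately have "eventually (\<lambda>k. False) \<omega>"
      using val
    proof eventually_elim
      case (elim k)
      \<comment> \<open>Both values lie strictly below something, hence are finite, so strict
        inequalities may be added in \<open>ennreal\<close>.\<close>
      hence "\<nu> k a + \<nu> k b < of_nat m * g k + of_nat n * g k"
        by (intro add_strict_mono) (auto simp: not_le)
      also have "\<dots> = of_nat (m + n) * g k"
        by (simp add: distrib_right)
      also have "\<dots> \<le> \<nu> k a + \<nu> k b"
        using elim ab by (simp add: valuation_def)
      finally show ?case by simp
    qed
    with nontriv show False by (simp add: eventually_False)
  qed
  ultimately show ?thesis
    by (intro primeidealI) (auto simp: assms)
qed

text \<open>The element \<open>a\<close> separates the two ideals: its valuation has the same order
  of magnitude as \<open>h\<close>, which beats every multiple of \<open>g\<close> but not the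
  multiple \<open>3 * h\<close>.\<close>

lemma dominating_ideal_psubset:
  assumes nontriv: "\<omega> \<noteq> bot"
    and pos: "eventually (\<lambda>k. 0 < g k \<and> h k < \<infinity> \<and> 0 < h k) \<omega>"
    and growth: "\<And>n. eventually (\<lambda>k. of_nat n * g k \<le> h k) \<omega>"
    and a: "a \<in> carrier R"
    and lower: "eventually (\<lambda>k. h k \<le> \<nu> k a) \<omega>"
    and upper: "eventually (\<lambda>k. \<nu> k a \<le> 2 * h k) \<omega>"
  shows "dominating_ideal R \<omega> \<nu> h \<subset> dominating_ideal R \<omega> \<nu> g"
proof -
  have "eventually (\<lambda>k. of_nat n * g k \<le> \<nu> k a) \<omega>" for n
    using growth[of n] lower by eventually_elim (rule order_trans)
  hence "a \<in> dominating_ideal R \<omega> \<nu> g"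
    using a by (simp add: dominating_ideal_def)
  moreover have "a \<notin> dominating_ideal R \<omega> \<nu> h"
  proof
    assume "a \<in> dominating_ideal R \<omega> \<nu> h"
    hence "eventually (\<lambda>k. of_nat 3 * h k \<le> \<nu> k a) \<omega>"
      unfolding dominating_ideal_def by blast
    with upper pos have "eventually (\<lambda>k. False) \<omega>"
    proof eventually_elim
      case (elim k)
      hence "3 * h k \<le> 2 * h k" by simp
      \<comment> \<open>The contradiction needs \<open>h k\<close> to be neither \<open>0\<close>
        nor infinite, since \<open>3 * h k \<le> 2 * h k\<close> holds for both.\<close>
      moreover obtain x where "h k = ennreal x" "0 < x"
        using elim by (cases "h k") auto
      ultimately show False
        by (simp add: ennreal_mult'[symmetric] flip: ennreal_numeral)
    qed
    with nontriv show False by (simp add: eventually_False)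
  qed
  moreover have "dominating_ideal R \<omega> \<nu> h \<subseteq> dominating_ideal R \<omega> \<nu> g"
    using growth[of 1] by (intro dominating_ideal_antimono) simp
  ultimately show ?thesis by blast
qed

lemma powr_dominates:
  assumes "s < (t :: real)"
  shows "eventually (\<lambda>k :: nat. of_nat n * ennreal (real k powr s) \<le> ennreal (real k powr t)) sequentially"
proof -
  \<comment> \<open>The quotient of the two powers is \<open>k powr (t - s)\<close>; it reaches
    \<open>n\<close> once \<open>k\<close> passes this root of \<open>n\<close>.\<close>
  have "eventually (\<lambda>k :: nat. real n powr (1 / (t - s)) \<le> real k) sequentially"
    using filterlim_real_sequentially by (simp add: filterlim_at_top)
  hence "eventually (\<lambda>k :: nat. real n \<le> real k powr (t - s)) sequentially"
  proof eventually_elim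
    case (elim k)
    hence "(real n powr (1 / (t - s))) powr (t - s) \<le> real k powr (t - s)"
      using assms by (intro powr_mono2) auto
    thus ?case using assms by (simp add: powr_powr)
  qed
  thus ?thesis
  proof eventually_elim
    case (elim k)
    have "real n * real k powr s \<le> real k powr (t - s) * real k powr s"
      using elim by (intro mult_right_mono) auto
    also have "\<dots> = real k powr t"
      by (simp flip: powr_add)
    finally show ?case
      by (simp add: ennreal_of_nat_eq_real_of_nat ennreal_leI flip: ennreal_mult')
  qed
qed

lemma eventually_eq_of_seq_class_eq:
  assumes "seq_class \<omega> x = seq_class \<omega> y"
  shows "eventually (\<lambda>k. x k = y k) \<omega>"
proof -
  have "y \<in> seq_class \<omega> y"
    by (simp add: seq_class_def seq_rel_def)
  hence "y \<in> seq_class \<omega> x" using assms by simp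
  thus ?thesis by (simp add: seq_class_def seq_rel_def)
qed

text \<open>Links the cardinal statement to the \<open>enat\<close>-valued dimension: a chain of
  continuum size is infinite, so its \<open>chain_length\<close> is already the top value.\<close>

lemma krull_dim_eq_infinity:
  assumes "krull_dim_ge_continuum R"
  shows "krull_dim R = \<infinity>"
proof -
  from assms obtain C where C: "prime_chain R C" "C \<approx> (UNIV :: real set)"
    unfolding krull_dim_ge_continuum_def by blast
  hence "infinite C"
    using eqpoll_finite_iff infinite_UNIV_char_0 by blast
  hence "C \<noteq> {}" "chain_length C = \<infinity>"
    by (auto simp: chain_length_def)
  have "chain_length C \<le> krull_dim R"
    unfolding krull_dim_def by (rule Sup_upper) (use C(1) \<open>C \<noteq> {}\<close> in blast)
  thus ?thesis using \<open>chain_length C = \<infinity>\<close> by simp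
qed

theorem theorem4:
  fixes R :: "('a, 'b) ring_scheme" and \<omega> :: "nat filter"
  assumes "nonprincipal_ultrafilter \<omega>"
    and "cring R"
    and "ample \<omega> R"
  shows "krull_dim_ge_continuum R \<and> krull_dim R = \<infinity>"
proof -
  have nontriv: "\<omega> \<noteq> bot"
    and ultra: "\<And>P. eventually P \<omega> \<or> eventually (\<lambda>k. \<not> P k) \<omega>"
    using assms(1) by (auto simp: nonprincipal_ultrafilter_def)
  have seq: "eventually P \<omega>" if "eventually P sequentially" for P
    using nonprincipal_ultrafilter_le_sequentially[OF assms(1)] that by (simp add: le_filter_def)
  have ge1: "eventually (\<lambda>k. 1 \<le> k) \<omega>"
    by (rule seq[OF eventually_ge_at_top])
  from assms(3) obtain \<nu> where val: "\<forall>k\<ge>1. valuation R (\<nu> k)"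
    and amp: "\<forall>\<beta>\<in>hypernats \<omega>. \<exists>a\<in>carrier R. seq_class \<omega> (\<lambda>k. \<nu> k a) = \<beta>"
    unfolding ample_def by (elim exE conjE)
  \<comment> \<open>Writing the positive exponent as \<open>exp t\<close> indexes the chain by all
    of the reals and preserves the order.\<close>
  define h where "h = (\<lambda>(t::real) (k::nat). ennreal (real k powr exp t))"
  define I where "I = (\<lambda>t. dominating_ideal R \<omega> \<nu> (h t))"
  have pos: "eventually (\<lambda>k. 0 < h t k) \<omega>" for t
    using ge1 by eventually_elim (simp add: h_def)
  have prime: "primeideal (I t) R" for t
    unfolding I_def using assms(2) nontriv ultra _ pos
    by (rule primeideal_dominating_ideal) (use ge1 val in \<open>auto elim: eventually_mono\<close>)
  have strict: "I t \<subset> I s" if "s < t" for s t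
  proof -
    \<comment> \<open>Rounding up gives a natural number sequence. For \<open>k \<ge> 1\<close> the
      power is at least 1, so rounding at most doubles it and the entries are positive, as
      \<open>hypernats\<close> demands.\<close>
    define n where "n = (\<lambda>k::nat. nat \<lceil>real k powr exp t\<rceil>)"
    have n: "real k powr exp t \<le> real (n k)" "real (n k) \<le> 2 * real k powr exp t" "1 \<le> n k"
      if "k \<ge> 1" for k
    proof -
      have "1 \<le> real k powr exp t"
        using that by (intro ge_one_powr_ge_zero) auto
      thus "real k powr exp t \<le> real (n k)" "real (n k) \<le> 2 * real k powr exp t" "1 \<le> n k"
        unfolding n_def by linarith+
    qed
    have "seq_class \<omega> (\<lambda>k. of_nat (n k)) \<in> hypernats \<omega>"
      unfolding hypernats_def using n(3) by blast
    then obtain a where a: "a \<in> carrier R" "seq_class \<omega> (\<lambda>k. \<nu> k a) = seq_class \<omega> (\<lambda>k. of_nat (n k))"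
      using amp by blast
    hence eq: "eventually (\<lambda>k. \<nu> k a = of_nat (n k)) \<omega>"
      by (intro eventually_eq_of_seq_class_eq)
    show ?thesis
      unfolding I_def
    proof (rule dominating_ideal_psubset[OF nontriv _ _ a(1)])
      show "eventually (\<lambda>k. 0 < h s k \<and> h t k < \<infinity> \<and> 0 < h t k) \<omega>"
        using pos[of s] pos[of t] by eventually_elim (simp add: h_def)
      show "eventually (\<lambda>k. of_nat m * h s k \<le> h t k) \<omega>" for m
        unfolding h_def by (rule seq[OF powr_dominates]) (use that in simp)
      show "eventually (\<lambda>k. h t k \<le> \<nu> k a) \<omega>"
        using eq ge1
        by eventually_elim (simp add: h_def n ennreal_of_nat_eq_real_of_nat ennreal_leI)
      show "eventually (\<lambda>k. \<nu> k a \<le> 2 * h t k) \<omega>"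
        using eq ge1
      proof eventually_elim
        case (elim k)
        have "ennreal (real (n k)) \<le> ennreal (2 * real k powr exp t)"
          using elim n by (intro ennreal_leI) auto
        also have "\<dots> = 2 * h t k"
          by (simp add: h_def ennreal_mult')
        finally show ?case
          using elim by (simp add: ennreal_of_nat_eq_real_of_nat)
      qed
    qed
  qed
  \<comment> \<open>Strict monotonicity makes the family injective, so its range has exactly as many
    members as there are reals.\<close>
  have "inj I"
    by (rule linorder_injI) (use strict in blast)
  hence "range I \<approx> (UNIV :: real set)"
    by (simp add: inj_on_image_eqpoll_self)
  moreover have "prime_chain R (range I)"
    unfolding prime_chain_def subset_chain_def
  proof (intro conjI ballI)
    show "range I \<subseteq> {P. primeideal P R}" using prime by blast
    fix X Y assume "X \<in> range I" "Y \<in> range I"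
    then obtain s t where "X = I s" "Y = I t" by blast
    thus "X \<subseteq> Y \<or> Y \<subseteq> X"
      using strict by (cases s t rule: linorder_cases) blast+
  qed
  ultimately have "krull_dim_ge_continuum R"
    unfolding krull_dim_ge_continuum_def by blast
  thus ?thesis by (simp add: krull_dim_eq_infinity)
qed

end
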